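(* For every finite forest $F$, the right-angled Artin group $A(F)$ embeds into a one-relator group; that is, there is a group defined by a group presentation with a single defining relation which contains a subgroup isomorphic to $A(F)$.
   Context: For a finite simplicial graph $\Gamma$ (finite, undirected, no loops or multiple edges) with vertex set $V\Gamma$ and edge set $E\Gamma$ (a set of two-element subsets of $V\Gamma$), the right-angled Artin group $A(\Gamma)$ is the group defined by the presentation with generating set $V\Gamma$ and defining relations $uv = vu$ for all $\{u,v\} \in E\Gamma$ (and no other relations). A forest is a graph with no cycles. *)

theory Defs
  imports "HOL-Algebra.Group"
begin

section \<open>Finite simplicial graphs and forests\<close>

definition finite_simplicial_graph :: "'a set \<Rightarrow> 'a set set \<Rightarrow> bool" where
  "finite_simplicial_graph V E \<longleftrightarrow> finite V \<and> (\<forall>e\<in>E. e \<subseteq> V \<and> card e = 2)"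

text \<open>A cycle is given by its list of pairwise distinct vertices, the last one being joined
  to the first; the length bound excludes traversing a single edge back and forth.\<close>

definition graph_cycle :: "'a set set \<Rightarrow> 'a list \<Rightarrow> bool" where
  "graph_cycle E p \<longleftrightarrow> 3 \<le> length p \<and> distinct p \<and>
     (\<forall>i<length p. {p ! i, p ! (Suc i mod length p)} \<in> E)"

definition finite_forest :: "'a set \<Rightarrow> 'a set set \<Rightarrow> bool" where
  "finite_forest V E \<longleftrightarrow> finite_simplicial_graph V E \<and> (\<nexists>p. graph_cycle E p)"


section \<open>Groups given by presentations\<close>

text \<open>The letter \<open>(x, True)\<close> stands for the generator \<open>x\<close>, the letter \<open>(x, False)\<close> for its
  formal inverse.\<close>

type_synonym 'a gword = "('a \<times> bool) list"

definition gwords :: "'a set \<Rightarrow> 'a gword set" where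
  "gwords S = lists (S \<times> UNIV)"

definition inv_letter :: "'a \<times> bool \<Rightarrow> 'a \<times> bool" where
  "inv_letter a = (fst a, \<not> snd a)"

text \<open>A defining relation \<open>r = s\<close> is the pair \<open>(r, s)\<close>. The following is the least congruence
  on the monoid of words over \<open>S\<close> which contains all the defining relations and makes
  \<open>(x, True)\<close> and \<open>(x, False)\<close> mutually inverse.\<close>

inductive_set pres_cong :: "'a set \<Rightarrow> ('a gword \<times> 'a gword) set \<Rightarrow> ('a gword \<times> 'a gword) set"
  for S :: "'a set" and R :: "('a gword \<times> 'a gword) set" where
  refl: "w \<in> gwords S \<Longrightarrow> (w, w) \<in> pres_cong S R"
| sym: "(w, w') \<in> pres_cong S R \<Longrightarrow> (w', w) \<in> pres_cong S R"
| trans: "(w, w') \<in> pres_cong S R \<Longrightarrow> (w', w'') \<in> pres_cong S R \<Longrightarrow> (w, w'') \<in> pres_cong S R"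
| cancel: "u @ [a, inv_letter a] @ v \<in> gwords S \<Longrightarrow>
    (u @ [a, inv_letter a] @ v, u @ v) \<in> pres_cong S R"
| relation: "(r, s) \<in> R \<Longrightarrow> u @ r @ v \<in> gwords S \<Longrightarrow> u @ s @ v \<in> gwords S \<Longrightarrow>
    (u @ r @ v, u @ s @ v) \<in> pres_cong S R"

definition presented_group ::
  "'a set \<Rightarrow> ('a gword \<times> 'a gword) set \<Rightarrow> 'a gword set monoid" where
  "presented_group S R =
     \<lparr>carrier = gwords S // pres_cong S R,
      mult = (\<lambda>A B. pres_cong S R `` {u @ v | u v. u \<in> A \<and> v \<in> B}),
      one = pres_cong S R `` {[]}\<rparr>"

lemma pres_cong_gwords:
  "(w, w') \<in> pres_cong S R \<Longrightarrow> w \<in> gwords S \<and> w' \<in> gwords S"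
  by (induction rule: pres_cong.induct) (auto simp: gwords_def)

lemma equiv_pres_cong: "equiv (gwords S) (pres_cong S R)"
proof (rule equivI)
  show "pres_cong S R \<subseteq> gwords S \<times> gwords S"
    using pres_cong_gwords by fast
  show "refl_on (gwords S) (pres_cong S R)"
    by (auto simp: refl_on_def intro: pres_cong.refl)
  show "sym (pres_cong S R)"
    by (auto simp: sym_def intro: pres_cong.sym)
  show "trans (pres_cong S R)"
    unfolding trans_def using pres_cong.trans by metis
qed

lemma pres_cong_context:
  assumes "(w, w') \<in> pres_cong S R" "p \<in> gwords S" "q \<in> gwords S"
  shows "(p @ w @ q, p @ w' @ q) \<in> pres_cong S R"
  using assms(1)
proof induction
  case (refl w)
  then show ?case using assms by (intro pres_cong.refl) (auto simp: gwords_def)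
next
  case (sym w w')
  then show ?case by (blast intro: pres_cong.sym)
next
  case (trans w w' w'')
  then show ?case by (blast intro: pres_cong.trans)
next
  case (cancel u a v)
  then show ?case
    using assms pres_cong.cancel[of "p @ u" a "v @ q" S R] by (auto simp: gwords_def)
next
  case (relation r s u v)
  then show ?case
    using assms pres_cong.relation[of r s R "p @ u" "v @ q" S] by (auto simp: gwords_def)
qed

lemma pres_cong_append:
  assumes "(u, u') \<in> pres_cong S R" "(v, v') \<in> pres_cong S R"
  shows "(u @ v, u' @ v') \<in> pres_cong S R"
proof -
  have nil: "[] \<in> gwords S" by (simp add: gwords_def)
  have "(u @ v, u' @ v) \<in> pres_cong S R"
    using pres_cong_context[OF assms(1) nil, of v] pres_cong_gwords[OF assms(2)] by simp
  moreover have "(u' @ v, u' @ v') \<in> pres_cong S R"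
    using pres_cong_context[OF assms(2) _ nil, of u'] pres_cong_gwords[OF assms(1)] by simp
  ultimately show ?thesis by (rule pres_cong.trans)
qed

lemma presented_group_mult:
  assumes "u \<in> gwords S" "v \<in> gwords S"
  shows "pres_cong S R `` {u} \<otimes>\<^bsub>presented_group S R\<^esub> pres_cong S R `` {v}
    = pres_cong S R `` {u @ v}"
proof -
  have "(u, u) \<in> pres_cong S R" "(v, v) \<in> pres_cong S R"
    using assms by (auto intro: pres_cong.refl)
  then show ?thesis
    unfolding presented_group_def
    by (auto intro: pres_cong_append pres_cong.trans)
qed

lemma pres_cong_inverse:
  "w \<in> gwords S \<Longrightarrow> (rev (map inv_letter w) @ w, []) \<in> pres_cong S R"
proof (induction w)
  case Nil
  then show ?case by (auto intro: pres_cong.refl)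
next
  case (Cons a w)
  let ?w = "rev (map inv_letter w)"
  have w: "a \<in> S \<times> UNIV" "w \<in> gwords S" "?w \<in> gwords S" "inv_letter a \<in> S \<times> UNIV"
    using Cons.prems by (auto simp: gwords_def inv_letter_def in_lists_conv_set)
  have "inv_letter (inv_letter a) = a" by (simp add: inv_letter_def)
  moreover have "(?w @ [inv_letter a, inv_letter (inv_letter a)] @ w, ?w @ w) \<in> pres_cong S R"
    by (rule pres_cong.cancel) (use w in \<open>auto simp: gwords_def inv_letter_def\<close>)
  ultimately show ?case using pres_cong.trans[OF _ Cons.IH[OF w(2)]] by simp
qed

theorem group_presented_group: "group (presented_group S R)"
proof (rule groupI)
  let ?G = "presented_group S R" and ?c = "\<lambda>w. pres_cong S R `` {w}"
  have car: "carrier ?G = ?c ` gwords S" and one: "\<one>\<^bsub>?G\<^esub> = ?c []"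
    by (auto simp: presented_group_def quotient_def)
  have nil: "[] \<in> gwords S" by (simp add: gwords_def)
  have app: "u @ v \<in> gwords S" if "u \<in> gwords S" "v \<in> gwords S" for u v
    using that by (simp add: gwords_def)
  show "\<one>\<^bsub>?G\<^esub> \<in> carrier ?G" unfolding car one using nil by blast
  fix x assume "x \<in> carrier ?G"
  then obtain u where u: "u \<in> gwords S" "x = ?c u" unfolding car by blast
  show "\<one>\<^bsub>?G\<^esub> \<otimes>\<^bsub>?G\<^esub> x = x"
    unfolding one u(2) using presented_group_mult[OF nil u(1), of R] by simp
  have "rev (map inv_letter u) \<in> gwords S"
    using u(1) by (auto simp: gwords_def inv_letter_def in_lists_conv_set)
  moreover have "?c (rev (map inv_letter u) @ u) = ?c []"
    by (rule equiv_class_eq[OF equiv_pres_cong pres_cong_inverse[OF u(1)]])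
  ultimately show "\<exists>y\<in>carrier ?G. y \<otimes>\<^bsub>?G\<^esub> x = \<one>\<^bsub>?G\<^esub>"
    unfolding car one u(2) using presented_group_mult u(1) by blast
  fix y assume "y \<in> carrier ?G"
  then obtain v where v: "v \<in> gwords S" "y = ?c v" unfolding car by blast
  show "x \<otimes>\<^bsub>?G\<^esub> y \<in> carrier ?G"
    unfolding car u(2) v(2) using presented_group_mult[OF u(1) v(1)] app[OF u(1) v(1)] by blast
  fix z assume "z \<in> carrier ?G"
  then obtain w where w: "w \<in> gwords S" "z = ?c w" unfolding car by blast
  show "x \<otimes>\<^bsub>?G\<^esub> y \<otimes>\<^bsub>?G\<^esub> z = x \<otimes>\<^bsub>?G\<^esub> (y \<otimes>\<^bsub>?G\<^esub> z)"
    unfolding u(2) v(2) w(2) using u(1) v(1) w(1) by (simp add: presented_group_mult app)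
qed


section \<open>Right-angled Artin groups\<close>

definition raag :: "'a set \<Rightarrow> 'a set set \<Rightarrow> 'a gword set monoid" where
  "raag V E = presented_group V
     {([(u, True), (v, True)], [(v, True), (u, True)]) | u v. {u, v} \<in> E}"

end

theory Submission
  imports Defs
begin

text \<open>The one-relator group is \<open>Q = \<langle>a, t | a (t a t\<^sup>-\<^sup>1) = (t a t\<^sup>-\<^sup>1) a\<rangle>\<close>. Its
  elements \<open>A i = t\<^sup>i a t\<^sup>-\<^sup>i\<close> satisfy the relations of the right-angled Artin group of an infinite
  ray: consecutive ones commute. It is thus enough to realise the vertices of a forest by words in
  the \<open>A i\<close> so that no relations hold beyond those between adjacent vertices.

  A finite forest is an induced subgraph of the infinitely branching rooted tree
  (\<open>forest_address_exists\<close>), whose vertices are the lists of naturals and in which the children of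
  \<open>p\<close> are the lists \<open>j # p\<close>. The vertex \<open>p\<close> of depth \<open>d\<close> is sent to
  \<open>g\<^sup>-\<^sup>1 (A (d + 1))\<^sup>N g\<close>, where \<open>g\<close> is a product of powers of \<open>A 0, \<dots>, A (d - 1)\<close> whose
  exponents are the entries of \<open>p\<close>, and \<open>N\<close> is larger than all entries in use. Up to conjugation
  by the element \<open>g\<close> of the parent, passing to a child replaces \<open>(A (d + 1))\<^sup>N\<close> by a conjugate
  of \<open>(A (d + 2))\<^sup>N\<close> by a power of \<open>A d\<close>. Both \<open>A d\<close> and \<open>A (d + 2)\<close> commute with \<open>A (d + 1)\<close>,
  so the images of a parent and its child commute (\<open>vertex_elt_commute\<close>), and a homomorphism
  from the Artin group to \<open>Q\<close> results.

  Its injectivity is proved by exhibiting a permutation representation of \<open>Q\<close> which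
  contains the regular representation of the Artin group. Permutations \<open>b i\<close> of a set, consecutive
  ones commuting, extend to a representation of \<open>Q\<close> in which \<open>A i\<close> acts as \<open>b i\<close> (\<open>shift_group_perm_rep\<close>). Take
  pairs of an element of the Artin group and a sequence of digits, and let \<open>b i\<close> increase the digit
  \<open>i\<close> modulo \<open>N\<close>; when digit \<open>d + 1\<close> wraps around, the digits \<open>0, \<dots>, d - 1\<close> are read as an address,
  and the group component is multiplied by the vertex found there, if any. Consecutive \<open>b i\<close>
  commute because
  \<open>b (d + 1)\<close> ignores digit \<open>d\<close>, \<open>b d\<close> ignores digit \<open>d + 1\<close>, and the two vertices that they may
  multiply by are parent and child. Starting from zero digits, the word for a vertex \<open>v\<close> dials the
  address of \<open>v\<close>, makes the next but one digit run through a full period, and resets the address: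
  its net effect is multiplication by \<open>v\<close> (\<open>vertex_elt_odometer\<close>). Hence on states with zero digits
  the image of \<open>g\<close> multiplies by \<open>g\<close>, and \<open>g\<close> can be recovered from its image.\<close>

section \<open>Homomorphisms out of a presented group\<close>

definition pres_gen :: "'a set \<Rightarrow> ('a gword \<times> 'a gword) set \<Rightarrow> 'a \<Rightarrow> 'a gword set" where
  "pres_gen S R x = pres_cong S R `` {[(x, True)]}"

definition letter_val :: "('g, 'm) monoid_scheme \<Rightarrow> ('a \<Rightarrow> 'g) \<Rightarrow> 'a \<times> bool \<Rightarrow> 'g" where
  "letter_val G f a = (if snd a then f (fst a) else inv\<^bsub>G\<^esub> f (fst a))"

primrec word_val :: "('g, 'm) monoid_scheme \<Rightarrow> ('a \<Rightarrow> 'g) \<Rightarrow> 'a gword \<Rightarrow> 'g" where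
  "word_val G f [] = \<one>\<^bsub>G\<^esub>"
| "word_val G f (a # w) = letter_val G f a \<otimes>\<^bsub>G\<^esub> word_val G f w"

lemma (in group) letter_val_closed:
  "f \<in> S \<rightarrow> carrier G \<Longrightarrow> a \<in> S \<times> UNIV \<Longrightarrow> letter_val G f a \<in> carrier G"
  by (auto simp: letter_val_def)

lemma (in group) word_val_closed:
  assumes "f \<in> S \<rightarrow> carrier G"
  shows "w \<in> gwords S \<Longrightarrow> word_val G f w \<in> carrier G"
proof (induction w)
  case (Cons a w)
  then show ?case
    using letter_val_closed[OF assms, of a] by (simp add: gwords_def)
qed simp

lemma (in group) word_val_append:
  assumes f: "f \<in> S \<rightarrow> carrier G" and v: "v \<in> gwords S"
  shows "u \<in> gwords S \<Longrightarrow> word_val G f (u @ v) = word_val G f u \<otimes> word_val G f v"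
proof (induction u)
  case Nil
  then show ?case using word_val_closed[OF f v] by simp
next
  case (Cons a u)
  have "letter_val G f a \<in> carrier G" "u \<in> gwords S"
    using Cons.prems letter_val_closed[OF f, of a] by (auto simp: gwords_def)
  then show ?case
    using Cons.IH word_val_closed[OF f v] word_val_closed[OF f, of u] by (simp add: m_assoc)
qed

text \<open>The congruence is generated by free cancellation, which holds in every group, and by \<open>R\<close>.\<close>

lemma (in group) word_val_pres_cong:
  assumes f: "f \<in> S \<rightarrow> carrier G"
    and R: "\<And>r s. (r, s) \<in> R \<Longrightarrow> word_val G f r = word_val G f s"
    and "(w, w') \<in> pres_cong S R"
  shows "word_val G f w = word_val G f w'"
  using assms(3)
proof induction
  case (cancel u a v)
  have w: "u \<in> gwords S" "v \<in> gwords S" "[a, inv_letter a] \<in> gwords S" "a \<in> S \<times> UNIV"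
    using cancel by (auto simp: gwords_def)
  have "f (fst a) \<in> carrier G" using w(4) f by auto
  then have "word_val G f [a, inv_letter a] = \<one>"
    by (auto simp: letter_val_def inv_letter_def)
  moreover have "[a, inv_letter a] @ v \<in> gwords S" using w by (simp add: gwords_def)
  ultimately show ?case
    using w word_val_append[OF f] word_val_closed[OF f] by (metis l_one)
next
  case (relation r s u v)
  have w: "u \<in> gwords S" "v \<in> gwords S" "r \<in> gwords S" "s \<in> gwords S"
      "r @ v \<in> gwords S" "s @ v \<in> gwords S"
    using relation by (auto simp: gwords_def)
  then show ?case
    using word_val_append[OF f] R[OF relation(1)] by simp
qed simp_all

lemma presented_group_carrier:
  "carrier (presented_group S R) = (\<lambda>w. pres_cong S R `` {w}) ` gwords S"
  by (auto simp: presented_group_def quotient_def)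

lemma presented_group_one: "\<one>\<^bsub>presented_group S R\<^esub> = pres_cong S R `` {[]}"
  by (simp add: presented_group_def)

lemma pres_gen_closed: "x \<in> S \<Longrightarrow> pres_gen S R x \<in> carrier (presented_group S R)"
  by (auto simp: presented_group_carrier pres_gen_def gwords_def)

text \<open>The universal property of a presentation. Evaluation of words is constant on congruence
  classes, so any representative of a class may be used to define the homomorphism.\<close>

lemma presented_group_hom_exists:
  assumes "group G" and f: "f \<in> S \<rightarrow> carrier G"
    and R: "\<And>r s. (r, s) \<in> R \<Longrightarrow> word_val G f r = word_val G f s"
  obtains h where "h \<in> hom (presented_group S R) G"
    and "\<And>x. x \<in> S \<Longrightarrow> h (pres_gen S R x) = f x"
proof
  interpret group G by fact
  let ?h = "\<lambda>A. word_val G f (SOME w. w \<in> A)"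
  have h: "?h (pres_cong S R `` {w}) = word_val G f w" if "w \<in> gwords S" for w
  proof -
    have "w \<in> pres_cong S R `` {w}" using that by (auto intro: pres_cong.refl)
    then have "(SOME w'. w' \<in> pres_cong S R `` {w}) \<in> pres_cong S R `` {w}" by (rule someI)
    then show ?thesis using word_val_pres_cong[OF f R] by auto
  qed
  show "?h \<in> hom (presented_group S R) G"
  proof (rule homI)
    fix A assume "A \<in> carrier (presented_group S R)"
    then show "?h A \<in> carrier G"
      unfolding presented_group_carrier using h word_val_closed[OF f] by auto
  next
    fix A B assume "A \<in> carrier (presented_group S R)" "B \<in> carrier (presented_group S R)"
    then obtain u v where u: "u \<in> gwords S" "A = pres_cong S R `` {u}"
      and v: "v \<in> gwords S" "B = pres_cong S R `` {v}"
      unfolding presented_group_carrier by auto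
    have "u @ v \<in> gwords S" using u v by (simp add: gwords_def)
    then show "?h (A \<otimes>\<^bsub>presented_group S R\<^esub> B) = ?h A \<otimes>\<^bsub>G\<^esub> ?h B"
      unfolding u(2) v(2) presented_group_mult[OF u(1) v(1)] h[OF u(1)] h[OF v(1)]
      by (simp only: h word_val_append[OF f v(1) u(1)])
  qed
  fix x assume x: "x \<in> S"
  then have "f x \<in> carrier G" using f by auto
  moreover have "[(x, True)] \<in> gwords S" using x by (simp add: gwords_def)
  ultimately show "?h (pres_gen S R x) = f x"
    unfolding pres_gen_def by (simp only: h) (simp add: letter_val_def)
qed

text \<open>Evaluation of words makes it possible to compute in a presented group with its generators
  and group operations only, without reference to the underlying congruence classes.\<close>

lemma class_eq_word_val:
  "w \<in> gwords S \<Longrightarrow>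
    pres_cong S R `` {w} = word_val (presented_group S R) (pres_gen S R) w"
proof (induction w)
  case Nil
  then show ?case by (simp add: presented_group_one)
next
  case (Cons a w)
  let ?P = "presented_group S R" and ?c = "\<lambda>w. pres_cong S R `` {w}"
  interpret group ?P by (rule group_presented_group)
  obtain x b where a: "a = (x, b)" by force
  have x: "x \<in> S" and w: "w \<in> gwords S" using Cons.prems by (auto simp: gwords_def a)
  have l: "[(x, c)] \<in> gwords S" for c using x by (simp add: gwords_def)
  have "inv\<^bsub>?P\<^esub> pres_gen S R x = ?c [(x, False)]"
  proof (rule inv_equality)
    have "([] @ [(x, False), inv_letter (x, False)] @ [], [] @ []) \<in> pres_cong S R"
      by (rule pres_cong.cancel) (use x in \<open>simp add: gwords_def inv_letter_def\<close>)
    then have "?c [(x, False), (x, True)] = ?c []"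
      by (intro equiv_class_eq[OF equiv_pres_cong]) (simp add: inv_letter_def)
    then show "?c [(x, False)] \<otimes>\<^bsub>?P\<^esub> pres_gen S R x = \<one>\<^bsub>?P\<^esub>"
      by (simp add: pres_gen_def presented_group_mult[OF l l] presented_group_one)
    show "?c [(x, False)] \<in> carrier ?P"
      using l unfolding presented_group_carrier by (rule imageI)
  qed (rule pres_gen_closed[OF x])
  then have "letter_val ?P (pres_gen S R) a = ?c [a]"
    by (cases b) (auto simp: a letter_val_def pres_gen_def)
  then show ?case
    using Cons.IH[OF w] presented_group_mult[OF l w, of R] by (simp add: a)
qed

lemma presented_group_relation:
  assumes "(r, s) \<in> R" "r \<in> gwords S" "s \<in> gwords S"
  shows "word_val (presented_group S R) (pres_gen S R) r
    = word_val (presented_group S R) (pres_gen S R) s"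
proof -
  have "(r, s) \<in> pres_cong S R"
    using pres_cong.relation[of r s R "[]" "[]" S] assms by simp
  then show ?thesis
    using class_eq_word_val assms(2,3) equiv_class_eq[OF equiv_pres_cong] by metis
qed

lemma presented_group_generated:
  assumes H: "subgroup H (presented_group S R)"
    and gen: "\<And>x. x \<in> S \<Longrightarrow> pres_gen S R x \<in> H"
  shows "carrier (presented_group S R) \<subseteq> H"
proof -
  interpret H: subgroup H "presented_group S R" by fact
  have "word_val (presented_group S R) (pres_gen S R) w \<in> H" if "w \<in> gwords S" for w
    using that
  proof (induction w)
    case (Cons a w)
    then have "fst a \<in> S" "w \<in> gwords S" by (auto simp: gwords_def)
    then have "letter_val (presented_group S R) (pres_gen S R) a \<in> H"
      using gen by (auto simp: letter_val_def H.m_inv_closed)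
    then show ?case using Cons.IH \<open>w \<in> gwords S\<close> by (simp add: H.m_closed)
  qed (simp add: H.one_closed)
  then show ?thesis by (auto simp: presented_group_carrier class_eq_word_val)
qed

abbreviation comm_rels :: "'a set set \<Rightarrow> ('a gword \<times> 'a gword) set" where
  "comm_rels E \<equiv> {([(u, True), (v, True)], [(v, True), (u, True)]) | u v. {u, v} \<in> E}"

lemma raag_gens_commute:
  assumes "{u, v} \<in> E" "u \<in> V" "v \<in> V"
  shows "pres_gen V (comm_rels E) u \<otimes>\<^bsub>raag V E\<^esub> pres_gen V (comm_rels E) v
    = pres_gen V (comm_rels E) v \<otimes>\<^bsub>raag V E\<^esub> pres_gen V (comm_rels E) u"
proof -
  interpret group "raag V E" unfolding raag_def by (rule group_presented_group)
  have "pres_gen V (comm_rels E) u \<in> carrier (raag V E)"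
    "pres_gen V (comm_rels E) v \<in> carrier (raag V E)"
    using assms by (simp_all add: raag_def pres_gen_closed)
  moreover have "word_val (raag V E) (pres_gen V (comm_rels E)) [(u, True), (v, True)]
      = word_val (raag V E) (pres_gen V (comm_rels E)) [(v, True), (u, True)]"
    unfolding raag_def
    by (rule presented_group_relation) (use assms in \<open>auto simp: gwords_def\<close>)
  ultimately show ?thesis by (simp add: letter_val_def)
qed

section \<open>Permutation groups\<close>

text \<open>All bijections of a whole type are used, so that composition needs no restriction to a carrier.\<close>

definition perm_group :: "('x \<Rightarrow> 'x) monoid" where
  "perm_group = \<lparr>carrier = {f. bij f}, mult = (\<circ>), one = id\<rparr>"

lemma perm_group_simps [simp]:
  "f \<in> carrier perm_group \<longleftrightarrow> bij f"
  "f \<otimes>\<^bsub>perm_group\<^esub> g = f \<circ> g"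
  "\<one>\<^bsub>perm_group\<^esub> = id"
  by (auto simp: perm_group_def)

lemma group_perm_group: "group perm_group"
proof (rule groupI)
  fix f :: "'x \<Rightarrow> 'x" assume "f \<in> carrier perm_group"
  then have "bij f" by simp
  then show "\<exists>g\<in>carrier perm_group. g \<otimes>\<^bsub>perm_group\<^esub> f = \<one>\<^bsub>perm_group\<^esub>"
    by (intro bexI[of _ "inv_into UNIV f"]) (simp_all add: bij_imp_bij_inv bij_is_inj)
qed (auto simp: bij_comp comp_assoc)

interpretation perm: group perm_group
  by (rule group_perm_group)

lemma perm_group_inv: "bij f \<Longrightarrow> inv\<^bsub>perm_group\<^esub> f = inv_into UNIV f"
  by (rule perm.inv_equality) (simp_all add: bij_imp_bij_inv bij_is_inj)

lemma perm_group_pow: "f [^]\<^bsub>perm_group\<^esub> (n::nat) = f ^^ n"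
  by (induction n) (simp_all add: funpow_Suc_right del: funpow.simps(2))

text \<open>Left multiplication is extended by the identity outside the carrier to become a permutation
  of the whole type.\<close>

definition left_mult :: "('g, 'm) monoid_scheme \<Rightarrow> 'g \<Rightarrow> 'g \<Rightarrow> 'g" where
  "left_mult G g k = (if k \<in> carrier G then g \<otimes>\<^bsub>G\<^esub> k else k)"

lemma (in group) left_mult_mult:
  "g \<in> carrier G \<Longrightarrow> h \<in> carrier G \<Longrightarrow> left_mult G (g \<otimes> h) = left_mult G g \<circ> left_mult G h"
  by (auto simp: left_mult_def m_assoc)

lemma (in group) left_mult_one: "left_mult G \<one> = id"
  by (auto simp: left_mult_def)

lemma (in group) bij_left_mult: "g \<in> carrier G \<Longrightarrow> bij (left_mult G g)"
  using left_mult_mult[of g "inv g"] left_mult_mult[of "inv g" g] left_mult_one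
  by (intro o_bij[of "left_mult G (inv g)"]) auto


section \<open>The one-relator group\<close>

definition shift_rels :: "(nat gword \<times> nat gword) set" where
  "shift_rels = {([(0, True), (1, True), (0, True), (1, False)],
                  [(1, True), (0, True), (1, False), (0, True)])}"

definition shift_group :: "nat gword set monoid" where
  "shift_group = presented_group {0, 1} shift_rels"

primrec shift_conj :: "('g, 'm) monoid_scheme \<Rightarrow> 'g \<Rightarrow> 'g \<Rightarrow> nat \<Rightarrow> 'g" where
  "shift_conj G a t 0 = a"
| "shift_conj G a t (Suc i) = t \<otimes>\<^bsub>G\<^esub> shift_conj G a t i \<otimes>\<^bsub>G\<^esub> inv\<^bsub>G\<^esub> t"

definition shift_gen :: "nat \<Rightarrow> nat gword set" where
  "shift_gen = shift_conj shift_group (pres_gen {0, 1} shift_rels 0) (pres_gen {0, 1} shift_rels 1)"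

lemma (in group) shift_conj_closed:
  "a \<in> carrier G \<Longrightarrow> t \<in> carrier G \<Longrightarrow> shift_conj G a t i \<in> carrier G"
  by (induction i) auto

lemma (in group) conj_mult:
  assumes "t \<in> carrier G" "x \<in> carrier G" "y \<in> carrier G"
  shows "(t \<otimes> x \<otimes> inv t) \<otimes> (t \<otimes> y \<otimes> inv t) = t \<otimes> (x \<otimes> y) \<otimes> inv t"
  using assms by (simp add: m_assoc inv_solve_left')

text \<open>Conjugation by \<open>t\<close> carries the commutation of one pair of neighbours to the next pair, so
  that a single relation suffices.\<close>

lemma (in group) shift_conj_commute:
  assumes c: "a \<in> carrier G" "t \<in> carrier G"
    and 0: "a \<otimes> (t \<otimes> a \<otimes> inv t) = (t \<otimes> a \<otimes> inv t) \<otimes> a"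
  shows "shift_conj G a t i \<otimes> shift_conj G a t (Suc i)
    = shift_conj G a t (Suc i) \<otimes> shift_conj G a t i"
proof (induction i)
  case 0
  then show ?case using assms by simp
next
  case (Suc i)
  let ?x = "shift_conj G a t i" and ?y = "shift_conj G a t (Suc i)"
  have "?x \<in> carrier G" "?y \<in> carrier G"
    using c shift_conj_closed by blast+
  then have "(t \<otimes> ?x \<otimes> inv t) \<otimes> (t \<otimes> ?y \<otimes> inv t) = (t \<otimes> ?y \<otimes> inv t) \<otimes> (t \<otimes> ?x \<otimes> inv t)"
    using c Suc by (simp only: conj_mult)
  then show ?case by (simp only: shift_conj.simps(2))
qed

lemma (in group_hom) hom_shift_conj:
  assumes "a \<in> carrier G" "t \<in> carrier G"
  shows "h (shift_conj G a t i) = shift_conj H (h a) (h t) i"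
  using assms by (induction i) (simp_all add: G.shift_conj_closed)

lemma group_shift_group: "group shift_group"
  unfolding shift_group_def by (rule group_presented_group)

lemma shift_gen_closed: "shift_gen i \<in> carrier shift_group"
  unfolding shift_gen_def
  by (rule group.shift_conj_closed[OF group_shift_group])
    (auto simp: shift_group_def intro: pres_gen_closed)

lemma shift_gen_commute:
  "shift_gen i \<otimes>\<^bsub>shift_group\<^esub> shift_gen (Suc i)
    = shift_gen (Suc i) \<otimes>\<^bsub>shift_group\<^esub> shift_gen i"
proof -
  interpret group shift_group by (rule group_shift_group)
  let ?a = "pres_gen {0, 1} shift_rels 0" and ?t = "pres_gen {0, 1} shift_rels 1"
  have c: "?a \<in> carrier shift_group" "?t \<in> carrier shift_group"
    by (auto simp: shift_group_def intro: pres_gen_closed)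
  have "word_val shift_group (pres_gen {0, 1} shift_rels)
      [(0, True), (1, True), (0, True), (1, False)]
    = word_val shift_group (pres_gen {0, 1} shift_rels)
      [(1, True), (0, True), (1, False), (0, True)]"
    unfolding shift_group_def
    by (rule presented_group_relation) (auto simp: shift_rels_def gwords_def)
  then show ?thesis
    unfolding shift_gen_def using c
    by (intro shift_conj_commute) (simp_all add: letter_val_def m_assoc del: One_nat_def)
qed

text \<open>Stack copies of the set, one for each integer level, let \<open>a\<close> act on the copy at level
  \<open>m\<close> as \<open>b m\<close>, and let \<open>t\<close> move every copy one level down. Then \<open>t\<^sup>i a t\<^sup>-\<^sup>i\<close> acts on level \<open>0\<close> as
  \<open>b i\<close>, since \<open>t\<^sup>-\<^sup>i\<close> first moves up to level \<open>i\<close>. Extending \<open>b\<close> by the identity to negative levels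
  keeps consecutive permutations commuting.\<close>

lemma shift_group_perm_rep:
  fixes b :: "nat \<Rightarrow> 'x \<Rightarrow> 'x"
  assumes bij: "\<And>i. bij (b i)" and comm: "\<And>i. b i \<circ> b (Suc i) = b (Suc i) \<circ> b i"
  obtains h where "h \<in> hom shift_group (perm_group :: ('x \<times> int \<Rightarrow> 'x \<times> int) monoid)"
    and "\<And>i x. h (shift_gen i) (x, 0) = (b i x, 0)"
proof -
  define c where "c m = (if m < 0 then id else b (nat m))" for m :: int
  define a :: "'x \<times> int \<Rightarrow> 'x \<times> int" where "a = (\<lambda>(x, m). (c m x, m))"
  define t :: "'x \<times> int \<Rightarrow> 'x \<times> int" where "t = (\<lambda>(x, m). (x, m - 1))"
  define f where "f = (\<lambda>n::nat. if n = 0 then a else t)"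
  have t_apply: "t (x, m) = (x, m - 1)" for x m by (simp add: t_def)
  have c: "bij (c m)" for m using bij by (simp add: c_def)
  have cc: "c m (c (m + 1) x) = c (m + 1) (c m x)" for m x
  proof (cases "m < 0")
    case False
    then have "nat (m + 1) = Suc (nat m)" by simp
    then show ?thesis using False comm[of "nat m"] by (simp add: c_def fun_eq_iff)
  qed (simp add: c_def)
  have a: "bij a"
  proof (rule o_bij)
    let ?a' = "\<lambda>(x, m). (inv_into UNIV (c m) x, m)"
    show "?a' \<circ> a = id" "a \<circ> ?a' = id"
      using c by (auto simp: a_def fun_eq_iff bij_def inv_f_f surj_f_inv_f)
  qed
  have t': "(\<lambda>(x, m). (x, m + 1)) \<circ> t = id" "t \<circ> (\<lambda>(x, m). (x, m + 1)) = id"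
    by (auto simp: t_def fun_eq_iff)
  then have t: "bij t" by (rule o_bij)
  have "inv_into UNIV t = (\<lambda>(x, m). (x, m + 1))"
    using t' by (metis inv_unique_comp)
  then have ti: "inv\<^bsub>perm_group\<^esub> t = (\<lambda>(x, m). (x, m + 1))"
    by (simp add: perm_group_inv t)
  have sc: "shift_conj perm_group a t i (x, m) = (c (m + int i) x, m)" for i x m
  proof (induction i arbitrary: x m)
    case (Suc i)
    then show ?case by (simp add: ti t_apply algebra_simps)
  qed (simp add: a_def)
  have "word_val perm_group f [(0, True), (1, True), (0, True), (1, False)]
     = word_val perm_group f [(1, True), (0, True), (1, False), (0, True)]"
    using cc by (auto simp: letter_val_def f_def ti fun_eq_iff a_def t_apply add.commute)
  then obtain h where h: "h \<in> hom shift_group perm_group"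
    and hf: "\<And>n. n \<in> {0, 1} \<Longrightarrow> h (pres_gen {0, 1} shift_rels n) = f n"
    using presented_group_hom_exists[OF group_perm_group, of f "{0, 1}" shift_rels] a t
    by (auto simp: shift_rels_def f_def shift_group_def)
  interpret group_hom shift_group perm_group h
    by (simp add: group_hom_def group_hom_axioms_def group_shift_group group_perm_group h)
  have "h (shift_gen i) = shift_conj perm_group a t i" for i
    unfolding shift_gen_def
    by (subst hom_shift_conj) (auto simp: shift_group_def pres_gen_closed hf f_def simp del: One_nat_def)
  then have "h (shift_gen i) (x, 0) = (b i x, 0)" for i x
    by (simp add: sc c_def)
  then show ?thesis using that h by blast
qed

section \<open>The elements attached to the vertices of a rooted tree\<close>

text \<open>A list is the path from a vertex up to the root: its last entry is the branch taken at
  the root, which becomes the exponent of \<open>A 0\<close>.\<close>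

primrec pos_elt :: "('g, 'm) monoid_scheme \<Rightarrow> (nat \<Rightarrow> 'g) \<Rightarrow> nat list \<Rightarrow> 'g" where
  "pos_elt G A [] = \<one>\<^bsub>G\<^esub>"
| "pos_elt G A (j # p) = A (length p) [^]\<^bsub>G\<^esub> j \<otimes>\<^bsub>G\<^esub> pos_elt G A p"

text \<open>The power \<open>N\<close> is essential. For \<open>N = 1\<close> the image of \<open>p\<close> would conjugate those of its grandchildren
  \<open>i # j # p\<close> and \<open>Suc i # j # p\<close> to each other, a relation that does not hold in the Artin group.\<close>

definition vertex_elt :: "('g, 'm) monoid_scheme \<Rightarrow> (nat \<Rightarrow> 'g) \<Rightarrow> nat \<Rightarrow> nat list \<Rightarrow> 'g" where
  "vertex_elt G A N p = inv\<^bsub>G\<^esub> pos_elt G A p \<otimes>\<^bsub>G\<^esub> A (Suc (length p)) [^]\<^bsub>G\<^esub> N \<otimes>\<^bsub>G\<^esub> pos_elt G A p"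

lemma (in group) pos_elt_closed: "range A \<subseteq> carrier G \<Longrightarrow> pos_elt G A p \<in> carrier G"
  by (induction p) auto

lemma (in group) vertex_elt_closed: "range A \<subseteq> carrier G \<Longrightarrow> vertex_elt G A N p \<in> carrier G"
  by (simp add: vertex_elt_def pos_elt_closed range_subsetD)

lemma (in group_hom) hom_vertex_elt:
  assumes "range A \<subseteq> carrier G"
  shows "h (vertex_elt G A N p) = vertex_elt H (h \<circ> A) N p"
proof -
  have A: "A i \<in> carrier G" for i using assms by auto
  have "h (pos_elt G A p) = pos_elt H (h \<circ> A) p"
    by (induction p) (simp_all add: A G.pos_elt_closed[OF assms] hom_nat_pow)
  then show ?thesis
    by (simp add: vertex_elt_def A G.pos_elt_closed[OF assms] hom_nat_pow)
qed

lemma (in group) commute_pow: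
  assumes "x \<in> carrier G" "y \<in> carrier G" "x \<otimes> y = y \<otimes> x"
  shows "x [^] (m::nat) \<otimes> y [^] (n::nat) = y [^] n \<otimes> x [^] m"
  using group_commutes_pow[of x y m] group_commutes_pow[of y "x [^] m" n] assms by auto

lemma (in group) commute_conj:
  assumes c: "x \<in> carrier G" "y \<in> carrier G" "z \<in> carrier G"
    and xy: "x \<otimes> y = y \<otimes> x" and xz: "x \<otimes> z = z \<otimes> x"
  shows "x \<otimes> (inv y \<otimes> z \<otimes> y) = (inv y \<otimes> z \<otimes> y) \<otimes> x"
proof -
  have mult: "x \<otimes> (a \<otimes> b) = (a \<otimes> b) \<otimes> x"
    if "a \<in> carrier G" "b \<in> carrier G" "x \<otimes> a = a \<otimes> x" "x \<otimes> b = b \<otimes> x" for a b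
    using that c(1) by (metis m_assoc)
  have "x \<otimes> inv y = inv y \<otimes> (y \<otimes> x) \<otimes> inv y"
    using c by (simp add: m_assoc[symmetric])
  also have "\<dots> = inv y \<otimes> (x \<otimes> y) \<otimes> inv y" by (simp only: xy)
  also have "\<dots> = inv y \<otimes> x" using c by (simp add: m_assoc)
  finally show ?thesis using c xy xz by (intro mult) auto
qed

text \<open>Dropping the common conjugator of \<open>p\<close> and \<open>j # p\<close>, a power of \<open>A (d + 1)\<close> has to commute
  with a conjugate of a power of \<open>A (d + 2)\<close> by a power of \<open>A d\<close>, where \<open>d\<close> is the length of \<open>p\<close>.\<close>

lemma (in group) vertex_elt_commute:
  assumes A: "range A \<subseteq> carrier G" and comm: "\<And>i. A i \<otimes> A (Suc i) = A (Suc i) \<otimes> A i"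
  shows "vertex_elt G A N p \<otimes> vertex_elt G A N (j # p)
    = vertex_elt G A N (j # p) \<otimes> vertex_elt G A N p"
proof -
  let ?d = "length p"
  define g x y z where "g = pos_elt G A p" and "x = A (Suc ?d) [^] N"
    and "y = A ?d [^] j" and "z = A (Suc (Suc ?d)) [^] N"
  have Ai: "A i \<in> carrier G" for i using A by auto
  have cl: "g \<in> carrier G" "x \<in> carrier G" "y \<in> carrier G" "z \<in> carrier G"
    unfolding g_def x_def y_def z_def using Ai pos_elt_closed[OF A] by auto
  have "x \<otimes> y = y \<otimes> x" "x \<otimes> z = z \<otimes> x"
    unfolding x_def y_def z_def using Ai comm by (auto intro!: commute_pow)
  then have c: "x \<otimes> (inv y \<otimes> z \<otimes> y) = (inv y \<otimes> z \<otimes> y) \<otimes> x"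
    using cl commute_conj by blast
  have "vertex_elt G A N p = inv g \<otimes> x \<otimes> g"
    by (simp add: vertex_elt_def g_def x_def)
  moreover have "vertex_elt G A N (j # p) = inv g \<otimes> (inv y \<otimes> z \<otimes> y) \<otimes> g"
    using cl by (simp add: vertex_elt_def inv_mult_group m_assoc flip: g_def y_def z_def)
  ultimately show ?thesis
    using conj_mult[of "inv g" x "inv y \<otimes> z \<otimes> y"] conj_mult[of "inv g" "inv y \<otimes> z \<otimes> y" x] c cl
    by simp
qed

section \<open>Labelled odometers\<close>

text \<open>Digit \<open>0\<close> comes last, to match the exponent of \<open>A 0\<close> in the element attached to a list.\<close>

primrec address :: "(nat \<Rightarrow> nat) \<Rightarrow> nat \<Rightarrow> nat list" where
  "address s 0 = []"
| "address s (Suc d) = s d # address s d"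

text \<open>Addition of one modulo \<open>M + 1\<close>, extended by the identity to a permutation of all naturals.\<close>

definition cyc :: "nat \<Rightarrow> nat \<Rightarrow> nat" where
  "cyc M x = (if x < M then Suc x else if x = M then 0 else x)"

text \<open>The permutation applied when digit \<open>i\<close> wraps around. Digit \<open>i - 1\<close> is skipped when the
  address is read: the step at \<open>i\<close> must not depend on it if it is to commute with the step at \<open>i - 1\<close>.
  No vertex is attached to digit \<open>0\<close>, since the root belongs to digit \<open>1\<close>.\<close>

definition wrap_label :: "(nat list \<Rightarrow> 'k \<Rightarrow> 'k) \<Rightarrow> nat \<Rightarrow> (nat \<Rightarrow> nat) \<Rightarrow> 'k \<Rightarrow> 'k" where
  "wrap_label lab i s = (case i of 0 \<Rightarrow> id | Suc d \<Rightarrow> lab (address s d))"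

definition odometer :: "nat \<Rightarrow> (nat list \<Rightarrow> 'k \<Rightarrow> 'k) \<Rightarrow> nat \<Rightarrow> 'k \<times> (nat \<Rightarrow> nat) \<Rightarrow> 'k \<times> (nat \<Rightarrow> nat)" where
  "odometer M lab i = (\<lambda>(k, s). (if s i = M then wrap_label lab i s k else k, s(i := cyc M (s i))))"

lemma address_upd: "d \<le> i \<Longrightarrow> address (s(i := x)) d = address s d"
  by (induction d) auto

lemma wrap_label_upd: "i \<le> Suc j \<Longrightarrow> wrap_label lab i (s(j := x)) = wrap_label lab i s"
  by (auto simp: wrap_label_def address_upd split: nat.split)

lemma bij_cyc: "bij (cyc M)"
proof (rule o_bij)
  let ?f = "\<lambda>x. if x = 0 then M else if x \<le> M then x - 1 else x"
  show "?f \<circ> cyc M = id" "cyc M \<circ> ?f = id" by (auto simp: cyc_def fun_eq_iff)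
qed

text \<open>The inverse step can read the same label as the forward step, because the label at \<open>i\<close>
  does not depend on digit \<open>i\<close>.\<close>

lemma bij_odometer:
  assumes lab: "\<And>p. bij (lab p)"
  shows "bij (odometer M lab i)"
proof (rule o_bij)
  let ?x = "\<lambda>s. inv_into UNIV (cyc M) (s i)"
  let ?f = "\<lambda>(k, s). (if ?x s = M then inv_into UNIV (wrap_label lab i s) k else k, s(i := ?x s))"
  have "bij (wrap_label lab i s)" for s using lab by (simp add: wrap_label_def split: nat.split)
  then have l: "inv_into UNIV (wrap_label lab i s) (wrap_label lab i s k) = k"
      "wrap_label lab i s (inv_into UNIV (wrap_label lab i s) k) = k" for s k
    by (auto simp: bij_def inv_f_f surj_f_inv_f)
  have c: "inv_into UNIV (cyc M) (cyc M x) = x" "cyc M (inv_into UNIV (cyc M) x) = x" for x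
    using bij_cyc[of M] by (auto simp: bij_def inv_f_f surj_f_inv_f)
  show "?f \<circ> odometer M lab i = id" "odometer M lab i \<circ> ?f = id"
    by (auto simp: odometer_def fun_eq_iff wrap_label_upd l c)
qed

text \<open>Each of two consecutive steps leaves the label of the other unchanged, and the labels
  are attached to a list and its tail, that is, to a vertex of the tree and its parent.\<close>

lemma odometer_commute:
  assumes comm: "\<And>j p. lab p \<circ> lab (j # p) = lab (j # p) \<circ> lab p"
  shows "odometer M lab i \<circ> odometer M lab (Suc i) = odometer M lab (Suc i) \<circ> odometer M lab i"
proof -
  have "wrap_label lab i s (wrap_label lab (Suc i) s k)
      = wrap_label lab (Suc i) s (wrap_label lab i s k)" for s k
    using comm by (auto simp: wrap_label_def fun_eq_iff split: nat.split)
  then show ?thesis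
    by (auto simp: odometer_def fun_eq_iff wrap_label_upd)
qed

text \<open>Below \<open>M\<close> no digit wraps around, so no label is met. The map \<open>\<iota>\<close> allows the states to
  be part of a larger set on which \<open>B\<close> acts.\<close>

lemma odometer_pow:
  assumes B: "\<And>k s. B (\<iota> (k, s)) = \<iota> (odometer M lab i (k, s))"
  shows "s i + n \<le> M \<Longrightarrow> (B ^^ n) (\<iota> (k, s)) = \<iota> (k, s(i := s i + n))"
proof (induction n)
  case (Suc n)
  then have "(B ^^ n) (\<iota> (k, s)) = \<iota> (k, s(i := s i + n))" by linarith
  then have "(B ^^ Suc n) (\<iota> (k, s)) = \<iota> (odometer M lab i (k, s(i := s i + n)))"
    by (simp only: funpow.simps o_apply B)
  also have "odometer M lab i (k, s(i := s i + n)) = (k, s(i := s i + Suc n))"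
    using Suc.prems by (auto simp: odometer_def cyc_def fun_eq_iff)
  finally show ?case . 
qed simp

text \<open>The digits reached from zero by the element \<open>pos_elt\<close> of the list.\<close>

primrec pos_state :: "nat list \<Rightarrow> nat \<Rightarrow> nat" where
  "pos_state [] = (\<lambda>_. 0)"
| "pos_state (j # p) = (pos_state p)(length p := j)"

lemma pos_state_eq_0: "length p \<le> i \<Longrightarrow> pos_state p i = 0"
  by (induction p) auto

lemma address_pos_state: "address (pos_state p) (length p) = p"
  by (induction p)
    (simp_all only: pos_state.simps list.size add_Suc_right add_0_right address.simps
      fun_upd_same address_upd order_refl)

text \<open>Dialling \<open>p\<close> and undoing it meets no label, as the entries of \<open>p\<close> are at most \<open>M\<close>. The
  \<open>M + 1\<close> steps of digit \<open>length p + 1\<close> in between meet exactly one, when the digits spell \<open>p\<close>.\<close>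

lemma vertex_elt_odometer:
  fixes B :: "nat \<Rightarrow> 'y \<Rightarrow> 'y"
  assumes B: "\<And>i k s. B i (\<iota> (k, s)) = \<iota> (odometer M lab i (k, s))"
    and bij: "\<And>i. bij (B i)" and p: "\<forall>j\<in>set p. j \<le> M"
  shows "vertex_elt perm_group B (Suc M) p (\<iota> (k, \<lambda>_. 0)) = \<iota> (lab p k, \<lambda>_. 0)"
proof -
  let ?g = "pos_elt perm_group B p"
  have g: "?g (\<iota> (k, \<lambda>_. 0)) = \<iota> (k, pos_state p)" for k
    using p
  proof (induction p)
    case (Cons j p)
    then show ?case
      using odometer_pow[of "B (length p)" \<iota> M lab "length p", OF B, of "pos_state p" j k]
      by (simp add: perm_group_pow pos_state_eq_0 fun_upd_def)
  qed simp
  have bg: "bij ?g" using perm.pos_elt_closed[of B p] bij by (simp add: image_subset_iff)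
  let ?i = "Suc (length p)" and ?s = "pos_state p"
  \<comment> \<open>the first \<open>M\<close> steps bring the digit from \<open>0\<close> to \<open>M\<close>, and the last one wraps it around\<close>
  have "(B ?i ^^ Suc M) (\<iota> (k, ?s)) = B ?i (\<iota> (k, ?s(?i := M)))"
    using odometer_pow[of "B ?i" \<iota> M lab ?i, OF B, of ?s M k] by (simp add: pos_state_eq_0)
  also have "\<dots> = \<iota> (lab p k, ?s(?i := 0))"
    by (simp add: B odometer_def wrap_label_def cyc_def address_upd address_pos_state)
  also have "?s(?i := 0) = ?s" by (auto simp: pos_state_eq_0)
  finally have "(B ?i ^^ Suc M) (?g (\<iota> (k, \<lambda>_. 0))) = ?g (\<iota> (lab p k, \<lambda>_. 0))"
    by (simp add: g del: funpow.simps)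
  then have "inv_into UNIV ?g ((B ?i ^^ Suc M) (?g (\<iota> (k, \<lambda>_. 0)))) = \<iota> (lab p k, \<lambda>_. 0)"
    using bg by (simp only: bij_is_inj inv_f_f)
  then show ?thesis
    by (simp only: vertex_elt_def perm_group_simps perm_group_inv[OF bg] perm_group_pow o_apply)
qed

section \<open>Finite forests inside the tree of lists\<close>

lemma long_path_gives_cycle:
  assumes "distinct p" and path: "\<And>i. Suc i < length p \<Longrightarrow> {p ! i, p ! Suc i} \<in> E"
    and "{p ! 0, p ! i} \<in> E" "2 \<le> i" "i < length p"
  shows "graph_cycle E (take (Suc i) p)"
  unfolding graph_cycle_def
proof (intro conjI allI impI)
  show "3 \<le> length (take (Suc i) p)" "distinct (take (Suc i) p)"
    using assms by auto
  fix l assume "l < length (take (Suc i) p)"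
  then have l: "l \<le> i" and len: "length (take (Suc i) p) = Suc i" using assms by auto
  show "{take (Suc i) p ! l, take (Suc i) p ! (Suc l mod length (take (Suc i) p))} \<in> E"
  proof (cases "l = i")
    case True
    then show ?thesis using assms(3) len by (simp add: insert_commute)
  next
    case False
    then show ?thesis using l len path[of l] assms(5) by simp
  qed
qed

text \<open>The first vertex of a longest path has all its neighbours on the path, and a neighbour
  other than the second vertex would close a cycle.\<close>

lemma forest_leaf_exists:
  assumes F: "finite_forest V E" and "V \<noteq> {}"
  obtains x where "x \<in> V" "\<And>u v. {x, u} \<in> E \<Longrightarrow> {x, v} \<in> E \<Longrightarrow> u = v"
proof -
  have fin: "finite V" and E: "\<And>e. e \<in> E \<Longrightarrow> e \<subseteq> V \<and> card e = 2"
    using F by (auto simp: finite_forest_def finite_simplicial_graph_def)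
  define path where "path p \<longleftrightarrow> p \<noteq> [] \<and> distinct p \<and> set p \<subseteq> V \<and>
    (\<forall>i. Suc i < length p \<longrightarrow> {p ! i, p ! Suc i} \<in> E)" for p
  obtain y where "y \<in> V" using \<open>V \<noteq> {}\<close> by auto
  then have "path [y]" by (simp add: path_def)
  moreover have "\<forall>p. path p \<longrightarrow> length p < Suc (card V)"
    using fin by (metis card_mono distinct_card le_imp_less_Suc path_def)
  ultimately obtain p where p: "path p" and max: "\<And>q. path q \<Longrightarrow> length q \<le> length p"
    using ex_has_greatest_nat[of path "[y]" length] by blast
  obtain x q where xq: "p = x # q" using p by (cases p) (auto simp: path_def)
  have nb: "u = p ! Suc 0" if e: "{x, u} \<in> E" for u
  proof -
    have u: "u \<in> V" "u \<noteq> x" using E[OF e] by auto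
    have "u \<in> set p"
    proof (rule ccontr)
      assume "u \<notin> set p"
      have "{(u # p) ! i, (u # p) ! Suc i} \<in> E" if "Suc i < length (u # p)" for i
      proof (cases i)
        case 0
        then show ?thesis using e by (simp add: xq insert_commute)
      next
        case (Suc k)
        then show ?thesis using p that by (simp add: path_def)
      qed
      then have "path (u # p)" using p u \<open>u \<notin> set p\<close> by (simp add: path_def)
      then show False using max[of "u # p"] by simp
    qed
    then obtain i where i: "i < length p" "p ! i = u" by (auto simp: in_set_conv_nth)
    have "i \<noteq> 0" using u(2) i(2) xq by (metis nth_Cons_0)
    moreover have "\<not> 2 \<le> i"
    proof
      assume "2 \<le> i"
      moreover have "{p ! 0, p ! i} \<in> E" using e i by (simp add: xq)
      ultimately have "graph_cycle E (take (Suc i) p)"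
        using p i by (intro long_path_gives_cycle) (auto simp: path_def)
      then show False using F by (auto simp: finite_forest_def)
    qed
    ultimately have "i = Suc 0" by simp
    then show ?thesis using i by simp
  qed
  show ?thesis
    by (rule that[of x]) (use p nb in \<open>auto simp: path_def xq\<close>)
qed

definition tree_adj :: "nat list \<Rightarrow> nat list \<Rightarrow> bool" where
  "tree_adj p q \<longleftrightarrow> (\<exists>j. q = j # p \<or> p = j # q)"

lemma tree_adj_sym: "tree_adj p q = tree_adj q p"
  by (auto simp: tree_adj_def)

lemma finite_forest_remove:
  assumes "finite_forest V E"
  shows "finite_forest (V - {x}) {e \<in> E. x \<notin> e}"
proof -
  have "\<not> graph_cycle {e \<in> E. x \<notin> e} p" for p
    using assms by (auto simp: finite_forest_def graph_cycle_def)
  then show ?thesis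
    using assms by (auto simp: finite_forest_def finite_simplicial_graph_def)
qed

text \<open>Induction on the number of vertices: a vertex \<open>x\<close> with at most one neighbour gets a list \<open>p\<close>
  that starts with an entry \<open>j\<close> occurring in no other address. Then no address is a child of \<open>p\<close>, and
  \<open>x\<close> can only become adjacent to the tail of \<open>p\<close>. This is the address of the neighbour of \<open>x\<close> if there
  is one, and otherwise the unused list \<open>[j]\<close>.\<close>

lemma forest_address_exists:
  assumes "finite_forest V E"
  shows "\<exists>addr. inj_on addr V \<and> (\<forall>u\<in>V. \<forall>v\<in>V. {u, v} \<in> E \<longleftrightarrow> tree_adj (addr u) (addr v))"
  using assms
proof (induction "card V" arbitrary: V E)
  case 0
  then have "V = {}" by (simp add: finite_forest_def finite_simplicial_graph_def)
  then show ?case by simp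
next
  case (Suc n)
  have fin: "finite V" and E: "\<And>e. e \<in> E \<Longrightarrow> e \<subseteq> V \<and> card e = 2"
    using Suc.prems by (auto simp: finite_forest_def finite_simplicial_graph_def)
  obtain x where x: "x \<in> V" and leaf: "\<And>u v. {x, u} \<in> E \<Longrightarrow> {x, v} \<in> E \<Longrightarrow> u = v"
    using forest_leaf_exists[OF Suc.prems] Suc.hyps(2) by (metis card.empty nat.distinct(1))
  have "n = card (V - {x})" using Suc.hyps(2) x fin by simp
  from Suc.hyps(1)[OF this finite_forest_remove[OF Suc.prems]]
  obtain a where inj: "inj_on a (V - {x})"
    and adj: "\<And>u v. u \<in> V - {x} \<Longrightarrow> v \<in> V - {x} \<Longrightarrow> {u, v} \<in> E \<longleftrightarrow> tree_adj (a u) (a v)"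
    by auto
  have "finite (\<Union>v\<in>V. set (a v))" using fin by simp
  then obtain j where "j \<notin> (\<Union>v\<in>V. set (a v))" using ex_new_if_finite by blast
  then have j: "j \<notin> set (a v)" if "v \<in> V" for v using that by blast
  obtain p where new: "j \<in> set p"
    and p: "\<And>v. v \<in> V - {x} \<Longrightarrow> {x, v} \<in> E \<longleftrightarrow> tree_adj p (a v)"
  proof (cases "\<exists>u. {x, u} \<in> E")
    case True
    then obtain u where u: "{x, u} \<in> E" by blast
    have uV: "u \<in> V - {x}" using E[OF u] by auto
    have "{x, v} \<in> E \<longleftrightarrow> tree_adj (j # a u) (a v)" if v: "v \<in> V - {x}" for v
    proof -
      have "{x, v} \<in> E \<longleftrightarrow> v = u" using u leaf by blast
      also have "\<dots> \<longleftrightarrow> a v = a u" using inj v uV by (auto simp: inj_on_def)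
      also have "\<dots> \<longleftrightarrow> tree_adj (j # a u) (a v)" using j[of v] v by (auto simp: tree_adj_def)
      finally show ?thesis .
    qed
    then show ?thesis using that[of "j # a u"] by simp
  next
    case False
    have "\<not> tree_adj [j, j] (a v)" if "v \<in> V" for v
      using j[OF that] by (cases "a v") (auto simp: tree_adj_def)
    \<comment> \<open>\<open>[j]\<close> would not do: its parent, the root \<open>[]\<close>, may already be an address\<close>
    then show ?thesis using that[of "[j, j]"] False by simp
  qed
  have "\<not> tree_adj p p" by (auto simp: tree_adj_def)
  moreover have "{x, x} \<notin> E" using E[of "{x, x}"] by auto
  ultimately have "{u, v} \<in> E \<longleftrightarrow> tree_adj ((a(x := p)) u) ((a(x := p)) v)"
    if "u \<in> V" "v \<in> V" for u v
    using that p[of v] p[of u] adj[of u v] tree_adj_sym[of "a u" p] insert_commute[of u x "{}"]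
    by (cases "u = x"; cases "v = x") simp_all
  moreover have "inj_on (a(x := p)) V"
  proof -
    have "p \<notin> a ` (V - {x})" using new j by auto
    then have "inj_on (a(x := p)) (insert x (V - {x}))"
      using inj by (auto simp: inj_on_def)
    then show ?thesis using x by (simp add: insert_absorb)
  qed
  ultimately show ?case by blast
qed

section \<open>The embedding\<close>

theorem theorem2p2:
  fixes V :: "'a set" and E :: "'a set set"
  assumes "finite_forest V E"
  shows "\<exists>(S :: nat set) r s H.
    r \<in> gwords S \<and> s \<in> gwords S \<and>
    subgroup H (presented_group S {(r, s)}) \<and>
    raag V E \<cong> (presented_group S {(r, s)})\<lparr>carrier := H\<rparr>"
proof -
  have fin: "finite V" and E: "\<And>u v. {u, v} \<in> E \<Longrightarrow> u \<in> V \<and> v \<in> V"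
    using assms by (auto simp: finite_forest_def finite_simplicial_graph_def)
  let ?A = "raag V E" and ?Q = shift_group
  let ?x = "pres_gen V (comm_rels E)"
  interpret A: group ?A unfolding raag_def by (rule group_presented_group)
  interpret Q: group ?Q by (rule group_shift_group)
  have x: "?x v \<in> carrier ?A" if "v \<in> V" for v
    using that by (simp add: raag_def pres_gen_closed)
  obtain addr where inj: "inj_on addr V"
    and adj: "\<And>u v. u \<in> V \<Longrightarrow> v \<in> V \<Longrightarrow> {u, v} \<in> E \<longleftrightarrow> tree_adj (addr u) (addr v)"
    using forest_address_exists[OF assms] by blast
  have "finite (\<Union>v\<in>V. set (addr v))" using fin by simp
  then obtain M where M: "\<And>v j. v \<in> V \<Longrightarrow> j \<in> set (addr v) \<Longrightarrow> j \<le> M"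
    unfolding finite_nat_set_iff_bounded_le by blast
  have Q: "range shift_gen \<subseteq> carrier ?Q" using shift_gen_closed by blast
  define w where "w v = vertex_elt ?Q shift_gen (Suc M) (addr v)" for v
  have w: "w v \<in> carrier ?Q" for v unfolding w_def by (rule Q.vertex_elt_closed[OF Q])
  have w_comm: "w u \<otimes>\<^bsub>?Q\<^esub> w v = w v \<otimes>\<^bsub>?Q\<^esub> w u" if e: "{u, v} \<in> E" for u v
  proof -
    have "tree_adj (addr u) (addr v)" using adj E[OF e] e by blast
    then show ?thesis
      unfolding w_def tree_adj_def
      using Q.vertex_elt_commute[OF Q shift_gen_commute] by metis
  qed
  have w_rel: "word_val ?Q w r = word_val ?Q w s" if rel: "(r, s) \<in> comm_rels E" for r s
  proof -
    obtain u v where e: "{u, v} \<in> E" and rs: "r = [(u, True), (v, True)]" "s = [(v, True), (u, True)]"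
      using rel by auto
    show ?thesis using w_comm[OF e] w by (simp add: rs letter_val_def)
  qed
  have "\<exists>\<phi>. \<phi> \<in> hom ?A ?Q \<and> (\<forall>v\<in>V. \<phi> (?x v) = w v)"
    unfolding raag_def
    by (rule presented_group_hom_exists[OF Q.is_group, of w V "comm_rels E"])
      (use w w_rel in blast)+
  then obtain \<phi> where \<phi>: "\<phi> \<in> hom ?A ?Q" and \<phi>x: "\<And>v. v \<in> V \<Longrightarrow> \<phi> (?x v) = w v"
    by blast
  \<comment> \<open>addresses that carry no vertex of the forest have a trivial label\<close>
  define lab where
    "lab p = (if p \<in> addr ` V then left_mult ?A (?x (inv_into V addr p)) else id)" for p
  have lab_addr: "lab (addr v) = left_mult ?A (?x v)" if "v \<in> V" for v
    using that inj by (simp add: lab_def)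
  have bij_lab: "bij (lab p)" for p
    using x A.bij_left_mult by (auto simp: lab_def inv_into_into)
  \<comment> \<open>this is where the forest has to be an induced subgraph of the tree\<close>
  have lab_comm: "lab p \<circ> lab (j # p) = lab (j # p) \<circ> lab p" for j p
  proof (cases "p \<in> addr ` V \<and> (j # p) \<in> addr ` V")
    case True
    then obtain u v where uv: "u \<in> V" "v \<in> V" "p = addr u" "j # p = addr v" by blast
    then have "{u, v} \<in> E" using adj by (metis tree_adj_def)
    then have "?x u \<otimes>\<^bsub>?A\<^esub> ?x v = ?x v \<otimes>\<^bsub>?A\<^esub> ?x u"
      by (rule raag_gens_commute[OF _ uv(1,2)])
    then have "lab (addr u) \<circ> lab (addr v) = lab (addr v) \<circ> lab (addr u)"
      using uv x by (simp add: lab_addr flip: A.left_mult_mult)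
    then show ?thesis using uv by simp
  qed (auto simp: lab_def)
  obtain h where h: "h \<in> hom ?Q (perm_group :: (('a gword set \<times> (nat \<Rightarrow> nat)) \<times> int \<Rightarrow> _) monoid)"
    and h_gen: "\<And>i y. h (shift_gen i) (y, 0) = (odometer M lab i y, 0)"
    using shift_group_perm_rep[of "odometer M lab"] bij_odometer[of lab M, OF bij_lab]
      odometer_commute[of lab M, OF lab_comm] by metis
  interpret h: group_hom ?Q perm_group h
    by (simp add: group_hom_def group_hom_axioms_def Q.is_group group_perm_group h)
  have h_w: "h (w v) ((k, \<lambda>_. 0), 0) = ((left_mult ?A (?x v) k, \<lambda>_. 0), 0)" if "v \<in> V" for v k
  proof -
    have "bij (h (shift_gen i))" for i using h.hom_closed[OF shift_gen_closed] by simp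
    then show ?thesis
      using vertex_elt_odometer[of "h \<circ> shift_gen" "\<lambda>y. (y, 0)" M lab "addr v" k] h_gen M[OF that]
      by (simp add: w_def h.hom_vertex_elt[OF Q] lab_addr[OF that])
  qed
  interpret \<phi>: group_hom ?A ?Q \<phi>
    by (simp add: group_hom_def group_hom_axioms_def A.is_group Q.is_group \<phi>)
  \<comment> \<open>on states with zero digits, the representation restricts to the regular one\<close>
  let ?H = "{g \<in> carrier ?A. \<forall>k. h (\<phi> g) ((k, \<lambda>_. 0), 0) = ((left_mult ?A g k, \<lambda>_. 0), 0)}"
  have "subgroup ?H ?A"
  proof (rule A.subgroupI)
    show "?H \<noteq> {}"
      using A.one_closed by (auto simp: A.left_mult_one)
    fix g assume g: "g \<in> ?H"
    have "h (\<phi> (inv\<^bsub>?A\<^esub> g)) ((k, \<lambda>_. 0), 0) = ((left_mult ?A (inv\<^bsub>?A\<^esub> g) k, \<lambda>_. 0), 0)" for k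
    proof -
      let ?k = "left_mult ?A (inv\<^bsub>?A\<^esub> g) k"
      have "left_mult ?A g ?k = k"
        using g A.left_mult_mult[of g "inv\<^bsub>?A\<^esub> g"] by (simp add: A.left_mult_one fun_eq_iff)
      then have "h (\<phi> g) ((?k, \<lambda>_. 0), 0) = ((k, \<lambda>_. 0), 0)" using g by simp
      moreover have "h (\<phi> (inv\<^bsub>?A\<^esub> g)) \<circ> h (\<phi> g) = id"
        using g h.hom_mult[of "\<phi> (inv\<^bsub>?A\<^esub> g)" "\<phi> g"]
        by (simp flip: \<phi>.hom_mult del: \<phi>.hom_inv)
      ultimately show ?thesis by (metis comp_apply id_apply)
    qed
    then show "inv\<^bsub>?A\<^esub> g \<in> ?H" using g by simp
  next
    fix g g' assume "g \<in> ?H" "g' \<in> ?H"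
    then show "g \<otimes>\<^bsub>?A\<^esub> g' \<in> ?H" by (simp add: A.left_mult_mult)
  qed auto
  moreover have "?x v \<in> ?H" if "v \<in> V" for v
    using that x \<phi>x h_w by simp
  ultimately have H: "carrier ?A \<subseteq> ?H"
    unfolding raag_def by (rule presented_group_generated)
  have "inj_on \<phi> (carrier ?A)"
  proof (rule inj_onI)
    fix g g' assume g: "g \<in> carrier ?A" "g' \<in> carrier ?A" "\<phi> g = \<phi> g'"
    then have "left_mult ?A g \<one>\<^bsub>?A\<^esub> = left_mult ?A g' \<one>\<^bsub>?A\<^esub>"
      using H by (smt (verit) mem_Collect_eq prod.inject subset_iff)
    then show "g = g'" using g by (simp add: left_mult_def)
  qed
  then have "\<phi> \<in> iso ?A (?Q\<lparr>carrier := \<phi> ` carrier ?A\<rparr>)"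
    using \<phi> by (auto simp: iso_def hom_def bij_betw_def)
  then have "?A \<cong> ?Q\<lparr>carrier := \<phi> ` carrier ?A\<rparr>" by (rule is_isoI)
  moreover have "subgroup (\<phi> ` carrier ?A) ?Q" by (rule \<phi>.img_is_subgroup)
  ultimately show ?thesis
    unfolding shift_group_def shift_rels_def
    by (intro exI conjI) (auto simp: gwords_def)
qed

end
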